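(* Let $Y\subseteq\{0,1\}^{\mathbb{Z}}$ be a subshift and let $D_{0,0},D_{0,1},D_{1,0},D_{1,1},C$ be five blocks of the same length $\ell$ appearing in $Y$ and satisfying the following conditions: (a) $D_{0,0},D_{0,1},D_{1,0},D_{1,1},C$ are pairwise different. (b) The blocks $D_{0,0},D_{0,1},D_{1,0},D_{1,1}$ are mutually exchangeable in $Y$. (c) For all $\varepsilon,\delta\in\{0,1\}$ and $0\le m\le\ell$: if $C=(D_{\varepsilon,\delta}C)[m+1,m+\ell]$ then $m=\ell$, and if $C=(CD_{\varepsilon,\delta})[m+1,m+\ell]$ then $m=0$. (d) $Y$ contains the periodic element $\ldots CD_{0,0}CD_{0,0}\ldots CD_{0,0}C\ldots$. Then there exists an injective group homomorphism $\Phi:\mathrm{Aut}(\{0,1\}^{\mathbb{Z}})\to\mathrm{Aut}(Y)$.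
   Context: A subshift is a closed subset of $\{0,1\}^{\mathbb{Z}}$ invariant under the left shift $\sigma$, $(\sigma x)[n]=x[n+1]$. $\mathrm{Aut}(X)$ is the group, under composition, of all homeomorphisms $X\to X$ commuting with $\sigma$. A block is a finite word over $\{0,1\}$; $x[n,m]$ denotes the word $x[n]x[n+1]\ldots x[m]$; a block appears in $Y$ if it equals $y[n,m]$ for some $y\in Y$ and $n\le m$. Juxtaposition of blocks is concatenation, and the letters of a block of length $L$ are indexed $1,\ldots,L$ (so $(D_{\varepsilon,\delta}C)[m+1,m+\ell]$ is the subword of length $\ell$ of the concatenation starting at position $m+1$). Blocks $C_1,C_2,\ldots$ of the same length $\ell$ are mutually exchangeable in a set $Y\subseteq\{0,1\}^{\mathbb{Z}}$ if for every $y\in Y$: whenever $y[n+1,n+\ell]=C_i$ for some $n\in\mathbb{Z}$ and some $i$, then for every $j$ the sequence $y'$ defined by $y'[k]=y[k]$ for $k\in\mathbb{Z}\setminus[n+1,n+\ell]$ and $y'[n+1,n+\ell]=C_j$ belongs to $Y$. *)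

theory Defs
  imports "HOL-Analysis.Function_Topology" "HOL-Algebra.Bij"
begin

text \<open>
  The letters 0 and 1 are \<^const>\<open>False\<close> and \<^const>\<open>True\<close>.  The topology on
  \<open>int \<Rightarrow> bool\<close> is the library's product topology over the discrete type \<^typ>\<open>bool\<close>.
\<close>

type_synonym config = "int \<Rightarrow> bool"
type_synonym block = "bool list"

definition shift :: "config \<Rightarrow> config" where
  "shift x = (\<lambda>n. x (n + 1))"

text \<open>Invariance is \<open>\<sigma>(X) = X\<close>, not merely \<open>\<sigma>(X) \<subseteq> X\<close>.\<close>

definition subshift :: "config set \<Rightarrow> bool" where
  "subshift X \<longleftrightarrow> closed X \<and> shift ` X = X"

text \<open>
  As in \<^const>\<open>BijGroup\<close>, an element of the group is represented by the function that is
  \<^const>\<open>undefined\<close> outside \<open>X\<close>, so that distinct elements are distinct maps on \<open>X\<close>.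
\<close>

definition automorphisms :: "config set \<Rightarrow> (config \<Rightarrow> config) set" where
  "automorphisms X =
    {f \<in> extensional X. (\<exists>g. homeomorphism X X f g) \<and> (\<forall>x\<in>X. f (shift x) = shift (f x))}"

definition Aut :: "config set \<Rightarrow> (config \<Rightarrow> config) monoid" where
  "Aut X = BijGroup X \<lparr>carrier := automorphisms X\<rparr>"

lemma automorphisms_subset_Bij: "automorphisms X \<subseteq> Bij X"
proof
  fix f assume "f \<in> automorphisms X"
  then obtain g where "f \<in> extensional X" "homeomorphism X X f g"
    by (auto simp: automorphisms_def)
  then show "f \<in> Bij X"
    unfolding Bij_def homeomorphism_def by (auto simp: bij_betw_def intro: inj_on_inverseI)
qed

lemma subgroup_automorphisms:
  assumes X: "shift ` X = X"
  shows "subgroup (automorphisms X) (BijGroup X)"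
proof -
  interpret group "BijGroup X" by (rule group_BijGroup)
  have sx: "shift x \<in> X" if "x \<in> X" for x using X that by blast
  have comp: "compose X f g \<in> automorphisms X"
    if "f \<in> automorphisms X" "g \<in> automorphisms X" for f g
  proof -
    obtain f' g' where h: "homeomorphism X X f f'" "homeomorphism X X g g'"
      using \<open>f \<in> _\<close> \<open>g \<in> _\<close> by (auto simp: automorphisms_def)
    from homeomorphism_compose[OF h(2,1)]
    have "homeomorphism X X (f \<circ> g) (g' \<circ> f')" .
    then have "homeomorphism X X (compose X f g) (g' \<circ> f')"
      by (rule homeomorphism_cong) (auto simp: compose_def)
    moreover have "g x \<in> X" if "x \<in> X" for x
      using h(2) that by (auto simp: homeomorphism_def)
    ultimately show ?thesis
      using that sx by (auto simp: automorphisms_def compose_def)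
  qed
  have one: "(\<lambda>x\<in>X. x) \<in> automorphisms X"
  proof -
    have "homeomorphism X X (\<lambda>x\<in>X. x) (\<lambda>x. x)"
      by (rule homeomorphism_cong[OF homeomorphism_ident]) auto
    then show ?thesis using sx by (auto simp: automorphisms_def)
  qed
  have inv: "restrict (inv_into X f) X \<in> automorphisms X" if f: "f \<in> automorphisms X" for f
  proof -
    obtain g where g: "homeomorphism X X f g"
      and c: "\<And>x. x \<in> X \<Longrightarrow> f (shift x) = shift (f x)"
      using f by (auto simp: automorphisms_def)
    have gX: "g x \<in> X" "f (g x) = x" "g (f x) = x" "f x \<in> X" if "x \<in> X" for x
      using g that by (auto simp: homeomorphism_def)
    have "inj_on f X" using gX by (metis inj_onI)
    then have eq: "inv_into X f x = g x" if "x \<in> X" for x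
      using gX that by (metis inv_into_f_f)
    have "homeomorphism X X (restrict (inv_into X f) X) f"
      by (rule homeomorphism_cong[OF homeomorphism_symD[OF g]]) (auto simp: eq)
    moreover have "g (shift x) = shift (g x)" if "x \<in> X" for x
      using gX c sx that by metis
    ultimately show ?thesis using sx by (auto simp: automorphisms_def eq)
  qed
  show ?thesis
    by (rule subgroup.intro)
       (use automorphisms_subset_Bij[of X] comp one inv in
        \<open>auto simp: BijGroup_def inv_BijGroup[unfolded BijGroup_def] subset_iff\<close>)
qed

lemma group_Aut: "subshift X \<Longrightarrow> group (Aut X)"
  unfolding Aut_def subshift_def
  using subgroup.subgroup_is_group[OF subgroup_automorphisms group_BijGroup] by blast

definition word :: "config \<Rightarrow> int \<Rightarrow> int \<Rightarrow> block" where
  "word x n m = map x [n..m]"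

definition appears_in :: "block \<Rightarrow> config set \<Rightarrow> bool" where
  "appears_in w Y \<longleftrightarrow> (\<exists>y\<in>Y. \<exists>n m. n \<le> m \<and> w = word y n m)"

text \<open>The letters of a block are indexed from 1.\<close>

definition subword :: "block \<Rightarrow> nat \<Rightarrow> nat \<Rightarrow> block" where
  "subword w i j = map (\<lambda>k. w ! (k - 1)) [i..<Suc j]"

text \<open>\<open>put_block y n w\<close> writes \<open>w\<close> at the positions \<open>n + 1, \<dots>, n + length w\<close> of \<open>y\<close>.\<close>

definition put_block :: "config \<Rightarrow> int \<Rightarrow> block \<Rightarrow> config" where
  "put_block y n w =
    (\<lambda>k. if k \<in> {n + 1..n + int (length w)} then w ! nat (k - (n + 1)) else y k)"

definition mutually_exchangeable :: "block set \<Rightarrow> config set \<Rightarrow> bool" where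
  "mutually_exchangeable B Y \<longleftrightarrow>
    (\<forall>u\<in>B. \<forall>v\<in>B. length u = length v) \<and>
    (\<forall>y\<in>Y. \<forall>n. \<forall>u\<in>B. word y (n + 1) (n + int (length u)) = u \<longrightarrow>
      (\<forall>v\<in>B. put_block y n v \<in> Y))"

text \<open>The bi-infinite repetition \<open>\<dots>www\<dots>\<close>, with a copy of \<open>w\<close> starting at position 0.\<close>

definition periodic_config :: "block \<Rightarrow> config" where
  "periodic_config w = (\<lambda>n. w ! nat (n mod int (length w)))"

end

theory Submission
  imports Defs
begin

text \<open>
  Call a place of a configuration where some \<open>D \<epsilon> \<delta>\<close> stands between two copies of \<open>C\<close> a slot.  A
  slot stores two bits, \<open>\<epsilon>\<close> on an upper track and \<open>\<delta>\<close> on a lower track.  Condition (c) says that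
  \<open>C\<close> has no occurrence in \<open>D \<epsilon> \<delta> C\<close> or \<open>C D \<epsilon> \<delta>\<close> other than the visible one.  Hence no
  occurrence of \<open>C\<close> meets the inside of a slot, and overwriting the contents of all slots with
  arbitrary new bits neither destroys nor creates occurrences of \<open>C\<close>, nor slots
  (\<open>slot_refill\<close>).  By exchangeability and closedness it does not leave \<open>Y\<close> either
  (\<open>refill_in\<close>).

  Join the slots into conveyor belts: the upper track is read from left to right, the lower one
  from right to left, and wherever a maximal chain \<open>C D C D \<dots> D C\<close> of adjacent slots ends, the
  belt turns over to the other track.  The belt through a given slot and track then carries a
  bi-infinite sequence of bits, periodic when the chain is finite.  An automorphism \<open>\<phi>\<close> of the
  full shift acts on a configuration by applying \<open>\<phi>\<close> to every belt and writing the result back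
  (\<open>belt_map\<close>).  Where reading starts on a belt does not matter because \<open>\<phi>\<close> commutes with the
  shift, so the new belts are exactly the images of the old ones (\<open>belt_belt_map\<close>); as the slots,
  and with them the routes of the belts, stay in place, this action is compatible with
  composition (\<open>belt_map_comp\<close>).  It is continuous because any finite piece of a belt is
  determined by a finite window (\<open>continuous_belt_map\<close>).

  Finally, refilling the slots of the periodic point \<open>\<dots> C D C D C \<dots>\<close> puts any prescribed
  sequence on a single belt inside \<open>Y\<close> (\<open>every_config_on_belt\<close>), so \<open>\<phi>\<close> can be recovered from its
  action on \<open>Y\<close>.
\<close>

section \<open>Limits and shift-commuting maps\<close>

text \<open>
  The letters are discrete, so coordinatewise convergence means that each coordinate is eventually
  constant.  All topology below is reduced to statements of this form.
\<close>

lemma tendsto_config_iff: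
  fixes g :: "'a \<Rightarrow> config"
  shows "(g \<longlongrightarrow> x) F \<longleftrightarrow> (\<forall>k. eventually (\<lambda>z. g z k = x k) F)"
proof -
  have "(g \<longlongrightarrow> x) F \<longleftrightarrow> limitin (product_topology (\<lambda>_::int. euclidean :: bool topology) UNIV) g x F"
    by (simp add: euclidean_product_topology)
  also have "\<dots> \<longleftrightarrow> (\<forall>k. eventually (\<lambda>z. g z k = x k) F)"
    by (simp add: limitin_componentwise tendsto_discrete)
  finally show ?thesis .
qed

lemma continuous_on_config_iff:
  fixes f :: "config \<Rightarrow> config"
  shows "continuous_on UNIV f \<longleftrightarrow> (\<forall>x k. eventually (\<lambda>z. f z k = f x k) (nhds x))"
  by (simp add: continuous_on_def tendsto_at_iff_tendsto_nhds flip: tendsto_config_iff)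

lemma eventually_coordinate: "eventually (\<lambda>z. z k = x k) (nhds (x :: config))"
  using continuous_on_config_iff[of "\<lambda>x. x"] by (simp add: continuous_on_id)

definition shift_commuting :: "(config \<Rightarrow> config) \<Rightarrow> bool" where
  "shift_commuting \<phi> \<longleftrightarrow> (\<forall>x. \<phi> (shift x) = shift (\<phi> x))"

lemma shift_commuting_translate:
  assumes "shift_commuting \<phi>"
  shows "\<phi> (\<lambda>n. x (n + i)) = (\<lambda>n. \<phi> x (n + i))"
proof (induction i rule: int_induct[where k = 0])
  case base
  then show ?case by simp
next
  case (step1 i)
  have "\<phi> (\<lambda>n. x (n + (i + 1))) = \<phi> (shift (\<lambda>n. x (n + i)))"
    by (simp add: shift_def add_ac)
  also have "\<dots> = shift (\<phi> (\<lambda>n. x (n + i)))"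
    using assms by (simp add: shift_commuting_def)
  finally show ?case
    using step1 by (simp add: shift_def add_ac)
next
  case (step2 i)
  let ?z = "\<lambda>n. x (n + (i - 1))"
  have "shift (\<phi> ?z) = \<phi> (shift ?z)"
    using assms by (simp add: shift_commuting_def)
  also have "shift ?z = (\<lambda>n. x (n + i))"
    by (simp add: shift_def)
  also have "\<phi> (\<lambda>n. x (n + i)) = (\<lambda>n. \<phi> x (n + i))"
    by (rule step2)
  finally have eq: "shift (\<phi> ?z) = (\<lambda>n. \<phi> x (n + i))" .
  show ?case
  proof
    fix n show "\<phi> ?z n = \<phi> x (n + (i - 1))"
      using fun_cong[OF eq, of "n - 1"] by (simp add: shift_def algebra_simps)
  qed
qed

section \<open>Occurrences of a block\<close>

definition occurs :: "config \<Rightarrow> int \<Rightarrow> block \<Rightarrow> bool" where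
  "occurs y p w \<longleftrightarrow> (\<forall>i<length w. y (p + int i) = w ! i)"

lemma occurs_unique: "occurs y p u \<Longrightarrow> occurs y p v \<Longrightarrow> length u = length v \<Longrightarrow> u = v"
  by (auto simp: occurs_def intro: nth_equalityI)

lemma occurs_cong:
  assumes "\<And>k. q \<le> k \<Longrightarrow> k < q + int (length w) \<Longrightarrow> y k = z k"
  shows "occurs y q w \<longleftrightarrow> occurs z q w"
  using assms by (simp add: occurs_def)

lemma occurs_nth: "occurs y p w \<Longrightarrow> p \<le> k \<Longrightarrow> k < p + int (length w) \<Longrightarrow> y k = w ! nat (k - p)"
  unfolding occurs_def by (drule spec[of _ "nat (k - p)"]) auto

lemma occursI: "(\<And>k. p \<le> k \<Longrightarrow> k < p + int (length w) \<Longrightarrow> y k = w ! nat (k - p)) \<Longrightarrow> occurs y p w"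
  by (simp add: occurs_def)

lemma occurs_shift: "occurs (shift y) p w \<longleftrightarrow> occurs y (p + 1) w"
  by (simp add: occurs_def shift_def add_ac)

lemma occurs_word: "occurs y (n + 1) w \<longleftrightarrow> word y (n + 1) (n + int (length w)) = w"
proof -
  have "word y (n + 1) (n + int (length w)) ! i = y (n + 1 + int i)" if "i < length w" for i
    using that by (simp add: word_def nth_map)
  then show ?thesis
    unfolding occurs_def list_eq_iff_nth_eq by (simp add: word_def)
qed

text \<open>
  Translates an occurrence at an offset inside two adjacent blocks of a configuration into the
  language of \<^const>\<open>subword\<close>, in which condition (c) is phrased.
\<close>

lemma subword_of_append:
  assumes "occurs y p u" "occurs y (p + int l) v" "length u = l" "length v = l"
    and "occurs y (p + int m) w" "length w = l" "m \<le> l"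
  shows "w = subword (u @ v) (m + 1) (m + l)"
proof (rule nth_equalityI)
  show "length w = length (subword (u @ v) (m + 1) (m + l))"
    using assms by (simp add: subword_def)
next
  fix i assume "i < length w"
  then have i: "i < l" using assms by simp
  have "w ! i = y (p + int (m + i))"
    using assms i by (simp add: occurs_def add_ac)
  also have "\<dots> = (u @ v) ! (m + i)"
  proof (cases "m + i < l")
    case True
    then show ?thesis using assms by (auto simp: occurs_def nth_append)
  next
    case False
    have "y (p + int l + int (m + i - l)) = v ! (m + i - l)"
      using assms(2,4,7) i by (auto simp: occurs_def)
    with False show ?thesis
      using assms by (simp add: nth_append of_nat_diff)
  qed
  also have "\<dots> = subword (u @ v) (m + 1) (m + l) ! i"
    using i by (simp add: subword_def del: upt_Suc)
  finally show "w ! i = subword (u @ v) (m + 1) (m + l) ! i" .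
qed

lemma eventually_occurs_iff: "eventually (\<lambda>z. occurs z p w \<longleftrightarrow> occurs y p w) (nhds y)"
proof -
  have "eventually (\<lambda>z. \<forall>i\<in>{..<length w}. z (p + int i) = y (p + int i)) (nhds y)"
    by (intro eventually_ball_finite ballI eventually_coordinate) simp
  then show ?thesis
    by eventually_elim (auto simp: occurs_def)
qed

section \<open>Slots and their refilling\<close>

text \<open>
  The last two assumptions are condition (c), read off inside a configuration instead of on a
  concatenation of words.
\<close>

locale conveyor =
  fixes D :: "bool \<Rightarrow> bool \<Rightarrow> block" and C :: block and l :: nat
  assumes length_D: "length (D a b) = l" and length_C: "length C = l" and l_pos: "0 < l"
    and D_inj: "D a b = D a' b' \<Longrightarrow> a = a' \<and> b = b'"
    and C_in_DC: "\<lbrakk>occurs y p (D a b); occurs y (p + int l) C; occurs y q C; p \<le> q; q \<le> p + int l\<rbrakk>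
      \<Longrightarrow> q = p + int l"
    and C_in_CD: "\<lbrakk>occurs y (p - int l) C; occurs y p (D a b); occurs y q C; p - int l \<le> q; q \<le> p\<rbrakk>
      \<Longrightarrow> q = p - int l"
begin

definition slot :: "config \<Rightarrow> int \<Rightarrow> bool" where
  "slot y p \<longleftrightarrow> occurs y (p - int l) C \<and> (\<exists>a b. occurs y p (D a b)) \<and> occurs y (p + int l) C"

text \<open>
  The letter of one track is detected without knowing the other.  At a slot both existential
  quantifiers have a unique witness; the value elsewhere is junk.
\<close>

definition payload :: "config \<Rightarrow> int \<times> bool \<Rightarrow> bool" where
  "payload y q = (if snd q then \<exists>b. occurs y (fst q) (D True b) else \<exists>a. occurs y (fst q) (D a True))"

definition content :: "(int \<times> bool \<Rightarrow> bool) \<Rightarrow> int \<Rightarrow> block" where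
  "content f p = D (f (p, True)) (f (p, False))"

definition in_slot :: "config \<Rightarrow> int \<Rightarrow> int \<Rightarrow> bool" where
  "in_slot y k p \<longleftrightarrow> slot y p \<and> p \<le> k \<and> k < p + int l"

definition refill :: "config \<Rightarrow> (int \<times> bool \<Rightarrow> bool) \<Rightarrow> config" where
  "refill y f k =
    (if \<exists>p. in_slot y k p then (let p = THE p. in_slot y k p in content f p ! nat (k - p)) else y k)"

lemma length_content [simp]: "length (content f p) = l"
  by (simp add: content_def length_D)

lemma payload_eqI:
  assumes "occurs y p (D a b)"
  shows "payload y (p, t) = (if t then a else b)"
proof -
  have "occurs y p (D a' b') \<longleftrightarrow> a' = a \<and> b' = b" for a' b'
  proof
    assume "occurs y p (D a' b')"
    then have "D a' b' = D a b"
      by (rule occurs_unique[OF _ assms]) (simp add: length_D)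
    then show "a' = a \<and> b' = b" by (rule D_inj)
  qed (simp add: assms)
  then show ?thesis
    by (simp add: payload_def)
qed

lemma slot_occurs_payload: "slot y p \<Longrightarrow> occurs y p (content (payload y) p)"
  by (auto simp: slot_def content_def payload_eqI)

text \<open>
  The window of an occurrence of \<open>C\<close> that meets the inside of a slot has the length of the block
  there, so it lies within \<open>D C\<close> or within \<open>C D\<close>.  Condition (c) excludes both.
\<close>

lemma C_avoids_slot:
  assumes "slot y p" "occurs y q C"
  shows "q + int l \<le> p \<or> p + int l \<le> q"
proof (rule ccontr)
  assume *: "\<not> ?thesis"
  obtain a b where s: "occurs y (p - int l) C" "occurs y p (D a b)" "occurs y (p + int l) C"
    using assms(1) by (auto simp: slot_def)
  show False
    using C_in_DC[OF s(2,3) assms(2)] C_in_CD[OF s(1,2) assms(2)] * by linarith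
qed

text \<open>
  The copies of \<open>C\<close> on either side of one slot avoid the other slot.
\<close>

lemma slots_apart:
  assumes "slot y p" "slot y q" "p < q"
  shows "p + 2 * int l \<le> q"
  using C_avoids_slot[OF assms(1), of "q - int l"] C_avoids_slot[OF assms(2), of "p + int l"]
    assms l_pos by (auto simp: slot_def)

lemma in_slot_unique: "in_slot y k p \<Longrightarrow> in_slot y k q \<Longrightarrow> p = q"
  using slots_apart[of y p q] slots_apart[of y q p] l_pos
  by (cases p q rule: linorder_cases) (auto simp: in_slot_def)

lemma refill_in_slot:
  assumes "in_slot y k p"
  shows "refill y f k = content f p ! nat (k - p)"
proof -
  have "(THE p. in_slot y k p) = p"
    using assms by (rule the_equality) (rule in_slot_unique[OF _ assms])
  moreover have "\<exists>p. in_slot y k p" using assms ..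
  ultimately show ?thesis by (simp add: refill_def)
qed

lemma refill_outside: "\<nexists>p. in_slot y k p \<Longrightarrow> refill y f k = y k"
  by (simp add: refill_def)

lemma occurs_refill: "slot y p \<Longrightarrow> occurs (refill y f) p (content f p)"
  by (rule occursI) (simp add: refill_in_slot in_slot_def)

text \<open>
  All identities between refillings are instances of this characterisation.
\<close>

lemma eq_refillI:
  assumes "\<And>p. slot y p \<Longrightarrow> occurs z p (content f p)"
    and "\<And>k. \<nexists>p. in_slot y k p \<Longrightarrow> z k = y k"
  shows "z = refill y f"
proof
  fix k show "z k = refill y f k"
  proof (cases "\<exists>p. in_slot y k p")
    case True
    then obtain p where p: "in_slot y k p" ..
    then have "z k = content f p ! nat (k - p)"
      using assms(1) by (intro occurs_nth) (auto simp: in_slot_def)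
    with p show ?thesis by (simp add: refill_in_slot)
  qed (simp add: assms(2) refill_outside)
qed

lemma refill_payload: "refill y (payload y) = y"
  by (rule sym, rule eq_refillI) (auto simp: slot_occurs_payload)

lemma refill_cong: "(\<And>p t. slot y p \<Longrightarrow> f (p, t) = g (p, t)) \<Longrightarrow> refill y f = refill y g"
proof (rule eq_refillI)
  fix p assume *: "\<And>p t. slot y p \<Longrightarrow> f (p, t) = g (p, t)" and p: "slot y p"
  then have "content f p = content g p" by (simp add: content_def)
  with occurs_refill[OF p, of f] show "occurs (refill y f) p (content g p)" by simp
qed (rule refill_outside)

lemma occurs_refill_disjoint:
  assumes "\<And>p. slot y p \<Longrightarrow> q + int l \<le> p \<or> p + int l \<le> q" and "length w = l"
  shows "occurs (refill y f) q w \<longleftrightarrow> occurs y q w"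
proof (rule occurs_cong, rule refill_outside)
  fix k assume "q \<le> k" "k < q + int (length w)"
  then have "\<not> in_slot y k p" for p
    using assms(1)[of p] assms(2) by (auto simp: in_slot_def)
  then show "\<nexists>p. in_slot y k p" by blast
qed

text \<open>
  The two flanking copies of \<open>C\<close> survive since they meet no slot.
\<close>

lemma slot_refill_of_slot:
  assumes "slot y p"
  shows "slot (refill y f) p"
proof -
  have "occurs (refill y f) q C" if "occurs y q C" for q
    using occurs_refill_disjoint[of y q C f] C_avoids_slot that length_C by blast
  moreover have "\<exists>a b. occurs (refill y f) p (D a b)"
    using occurs_refill[OF assms, of f] by (auto simp: content_def)
  ultimately show ?thesis
    using assms by (simp add: slot_def)
qed

text \<open>
  For the converse inclusion, an occurrence of \<open>C\<close> in the refilled configuration avoids the old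
  slots, because these are still slots there; so it was present before.  If a new slot had appeared
  at \<open>p\<close>, its flanking copies of \<open>C\<close> would thus have been present, and would keep the window at
  \<open>p\<close> disjoint from every old slot, so that its block \<open>D a b\<close> would have been present as well.
\<close>

lemma slot_refill [simp]: "slot (refill y f) p \<longleftrightarrow> slot y p"
proof
  assume z: "slot (refill y f) p"
  have C: "occurs y q C" if "occurs (refill y f) q C" for q
    using occurs_refill_disjoint[of y q C f] C_avoids_slot[OF slot_refill_of_slot] that length_C
    by blast
  have Cp: "occurs y (p - int l) C" "occurs y (p + int l) C"
    using z by (auto simp: slot_def intro: C)
  show "slot y p"
  proof (rule ccontr)
    assume n: "\<not> slot y p"
    have "p + int l \<le> q \<or> q + int l \<le> p" if q: "slot y q" for q
    proof -
      have "q \<noteq> p" using n q by auto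
      then show ?thesis
        using C_avoids_slot[OF q Cp(1)] C_avoids_slot[OF q Cp(2)] by linarith
    qed
    then have "occurs y p (D a b) \<longleftrightarrow> occurs (refill y f) p (D a b)" for a b
      using occurs_refill_disjoint[of y p "D a b" f] length_D by blast
    with z Cp n show False
      by (auto simp: slot_def)
  qed
qed (rule slot_refill_of_slot)

lemma in_slot_refill [simp]: "in_slot (refill y f) k p \<longleftrightarrow> in_slot y k p"
  by (simp add: in_slot_def)

lemma refill_refill: "refill (refill y f) g = refill y g"
  by (rule eq_refillI) (use occurs_refill[of "refill y f" _ g] in \<open>auto simp: refill_outside\<close>)

lemma payload_refill: "slot y p \<Longrightarrow> payload (refill y f) (p, t) = f (p, t)"
  using payload_eqI[of "refill y f" p _ _ t] occurs_refill[of y p f] by (simp add: content_def)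

lemma slot_shift: "slot (shift y) p \<longleftrightarrow> slot y (p + 1)"
  by (simp add: slot_def occurs_shift algebra_simps)

lemma payload_shift: "payload (shift y) (p, t) = payload y (p + 1, t)"
  by (simp add: payload_def occurs_shift)

lemma refill_shift: "refill (shift y) (\<lambda>(p, t). f (p + 1, t)) = shift (refill y f)"
proof (rule sym, rule eq_refillI)
  fix p assume "slot (shift y) p"
  then show "occurs (shift (refill y f)) p (content (\<lambda>(p, t). f (p + 1, t)) p)"
    using occurs_refill[of y "p + 1" f] by (simp add: slot_shift occurs_shift content_def)
next
  fix k assume *: "\<nexists>p. in_slot (shift y) k p"
  have "\<not> in_slot y (k + 1) p" for p
  proof -
    have "\<not> in_slot (shift y) k (p - 1)" using * by blast
    then show ?thesis by (auto simp: in_slot_def slot_shift)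
  qed
  then show "shift (refill y f) k = shift y k"
    by (simp add: shift_def refill_outside)
qed

text \<open>
  One exchange at a time, by induction on the set of positions that may be rewritten.  Slots do not
  overlap, so an exchange at \<open>s\<close> leaves the contents of the other slots alone.
\<close>

lemma refill_finitely_many_in:
  assumes "mutually_exchangeable (range (case_prod D)) Y" "y \<in> Y" "finite S"
  shows "refill y (\<lambda>q. if fst q \<in> S then f q else payload y q) \<in> Y"
  using assms(3)
proof (induction S rule: finite_induct)
  case empty
  then show ?case using assms(2) by (simp add: refill_payload)
next
  case (insert s S)
  let ?g = "\<lambda>S q. if fst q \<in> S then f q else payload y q"
  show ?case
  proof (cases "slot y s")
    case False
    then have "refill y (?g (insert s S)) = refill y (?g S)"
      by (intro refill_cong) auto
    with insert show ?thesis by simp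
  next
    case True
    \<comment> \<open>The exchange is written at \<open>s - 1\<close>, as \<^const>\<open>put_block\<close> starts one position later.\<close>
    let ?z = "refill y (?g S)" and ?w = "content (?g (insert s S)) s"
    have "word ?z (s - 1 + 1) (s - 1 + int (length (content (?g S) s))) = content (?g S) s"
      using occurs_refill[OF True, of "?g S"] occurs_word[of ?z "s - 1" "content (?g S) s"] by simp
    then have "put_block ?z (s - 1) ?w \<in> Y"
      using assms(1) insert.IH unfolding mutually_exchangeable_def content_def
      by (metis (no_types, lifting) case_prod_conv rangeI)
    also have "put_block ?z (s - 1) ?w = refill y (?g (insert s S))"
    proof (rule eq_refillI)
      fix p assume p: "slot y p"
      show "occurs (put_block ?z (s - 1) ?w) p (content (?g (insert s S)) p)"
      proof (cases "p = s")
        case True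
        then show ?thesis by (auto simp: put_block_def occurs_def)
      next
        case False
        then have "p + 2 * int l \<le> s \<or> s + 2 * int l \<le> p"
          using slots_apart[OF p \<open>slot y s\<close>] slots_apart[OF \<open>slot y s\<close> p] by linarith
        then have "occurs (put_block ?z (s - 1) ?w) p (content (?g S) p)
            \<longleftrightarrow> occurs ?z p (content (?g S) p)"
          by (intro occurs_cong) (auto simp: put_block_def)
        with False occurs_refill[OF p, of "?g S"] show ?thesis
          by (simp add: content_def)
      qed
    next
      fix k assume k: "\<nexists>p. in_slot y k p"
      then have "\<not> (s \<le> k \<and> k < s + int l)"
        using True by (auto simp: in_slot_def)
      with k show "put_block ?z (s - 1) ?w k = y k"
        by (auto simp: put_block_def refill_outside)
    qed
    finally show ?thesis .
  qed
qed

text \<open>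
  A refilling is the limit of the refillings that rewrite only the slots in \<open>[-N, N]\<close>.
\<close>

lemma refill_in:
  assumes "closed Y" "mutually_exchangeable (range (case_prod D)) Y" "y \<in> Y"
  shows "refill y f \<in> Y"
proof -
  let ?z = "\<lambda>N::nat. refill y (\<lambda>q. if fst q \<in> {- int N..int N} then f q else payload y q)"
  have "eventually (\<lambda>N. ?z N k = refill y f k) sequentially" for k
  proof (cases "\<exists>p. in_slot y k p")
    case True
    then obtain p where p: "in_slot y k p" ..
    show ?thesis
      using eventually_ge_at_top[of "nat \<bar>p\<bar>"]
    proof eventually_elim
      case (elim N)
      then have "p \<in> {- int N..int N}" by auto
      then show ?case by (simp add: refill_in_slot[OF p] content_def)
    qed
  qed (simp add: refill_outside)
  then have "?z \<longlonglongrightarrow> refill y f"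
    by (simp add: tendsto_config_iff)
  moreover have "?z N \<in> Y" for N
    by (rule refill_finitely_many_in[OF assms(2,3)]) simp
  ultimately show ?thesis
    using closed_sequentially[OF assms(1), of ?z] by blast
qed

section \<open>The conveyor belts\<close>

text \<open>
  A site \<open>(p, t)\<close> is the upper (\<open>t = True\<close>) or lower (\<open>t = False\<close>) track at position \<open>p\<close>.  One
  step along a belt is written as a product of two involutions of the set of sites, so that it is
  invertible by construction: \<open>jump\<close> exchanges the upper site of a slot with the lower site of the
  next slot of its chain, and fixes the sites at which a chain ends.  Following it by \<open>flip\<close> gives a
  step straight ahead inside a chain and a change of track at its ends.
\<close>

definition flip :: "int \<times> bool \<Rightarrow> int \<times> bool" where
  "flip q = (fst q, \<not> snd q)"

definition ahead :: "int \<times> bool \<Rightarrow> int" where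
  "ahead q = (if snd q then fst q + 2 * int l else fst q - 2 * int l)"

text \<open>
  The test that \<open>q\<close> itself is at a slot matters only for sites off the slots; without it \<open>jump\<close>
  would not be an involution there.
\<close>

definition jump :: "config \<Rightarrow> int \<times> bool \<Rightarrow> int \<times> bool" where
  "jump y q = (if slot y (fst q) \<and> slot y (ahead q) then (ahead q, \<not> snd q) else q)"

definition advance :: "config \<Rightarrow> int \<times> bool \<Rightarrow> int \<times> bool" where
  "advance y q = flip (jump y q)"

definition retreat :: "config \<Rightarrow> int \<times> bool \<Rightarrow> int \<times> bool" where
  "retreat y q = jump y (flip q)"

definition travel :: "config \<Rightarrow> int \<Rightarrow> int \<times> bool \<Rightarrow> int \<times> bool" where
  "travel y i = (if 0 \<le> i then advance y ^^ nat i else retreat y ^^ nat (- i))"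

definition belt :: "config \<Rightarrow> int \<times> bool \<Rightarrow> config" where
  "belt y q i = payload y (travel y i q)"

lemma flip_flip [simp]: "flip (flip q) = q"
  by (simp add: flip_def)

lemma jump_jump [simp]: "jump y (jump y q) = q"
  by (cases q) (auto simp: jump_def ahead_def)

lemma retreat_advance [simp]: "retreat y (advance y q) = q"
  by (simp add: retreat_def advance_def)

lemma advance_retreat [simp]: "advance y (retreat y q) = q"
  by (simp add: retreat_def advance_def)

lemma travel_0 [simp]: "travel y 0 q = q"
  by (simp add: travel_def)

lemma travel_plus_1: "travel y (i + 1) q = advance y (travel y i q)"
proof (cases "0 \<le> i")
  case True
  then show ?thesis by (simp add: travel_def nat_add_distrib)
next
  case False
  then have "nat (- i) = Suc (nat (- (i + 1)))" by simp
  then show ?thesis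
    using False by (cases "i = - 1") (auto simp: travel_def)
qed

lemma travel_minus_1: "travel y (i - 1) q = retreat y (travel y i q)"
  using travel_plus_1[of y "i - 1" q] by simp

lemma travel_travel: "travel y i (travel y j q) = travel y (i + j) q"
proof (induction i rule: int_induct[where k = 0])
  case (step1 i)
  have "travel y (i + 1 + j) q = advance y (travel y (i + j) q)"
    using travel_plus_1[of y "i + j" q] by (simp add: add_ac)
  with step1 show ?case by (simp only: travel_plus_1)
next
  case (step2 i)
  have "travel y (i - 1 + j) q = retreat y (travel y (i + j) q)"
    using travel_minus_1[of y "i + j" q] by (simp add: algebra_simps)
  with step2 show ?case by (simp only: travel_minus_1)
qed simp

lemma belt_travel: "belt y (travel y j q) = (\<lambda>i. belt y q (i + j))"
  by (rule ext) (simp add: belt_def travel_travel)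

lemma slot_travel:
  assumes "slot y (fst q)"
  shows "slot y (fst (travel y i q))"
proof (induction i rule: int_induct[where k = 0])
  case (step1 i)
  then show ?case by (simp add: travel_plus_1 advance_def jump_def flip_def)
next
  case (step2 i)
  then show ?case by (simp add: travel_minus_1 retreat_def jump_def flip_def)
qed (simp add: assms)

lemma travel_refill [simp]: "travel (refill y f) = travel y"
proof -
  have "jump (refill y f) = jump y"
    by (rule ext) (simp add: jump_def)
  then have "advance (refill y f) = advance y" "retreat (refill y f) = retreat y"
    by (intro ext; simp add: advance_def retreat_def)+
  then show ?thesis by (intro ext) (simp add: travel_def)
qed

text \<open>
  Shifting a configuration moves its belts along without changing their routes.
\<close>

lemma travel_shift:
  "travel y i (p + 1, t) = apfst (\<lambda>p. p + 1) (travel (shift y) i (p, t))"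
proof -
  have *: "jump y (apfst (\<lambda>p. p + 1) q) = apfst (\<lambda>p. p + 1) (jump (shift y) q)"
    "flip (apfst (\<lambda>p. p + 1) q) = apfst (\<lambda>p. p + 1) (flip q)" for q
    by (cases q; simp add: jump_def ahead_def flip_def slot_shift algebra_simps)+
  show ?thesis
  proof (induction i rule: int_induct[where k = 0])
    case (step1 i)
    then show ?case by (simp add: travel_plus_1 advance_def *)
  next
    case (step2 i)
    then show ?case by (simp add: travel_minus_1 retreat_def *)
  qed simp
qed

lemma belt_shift: "belt (shift y) (p, t) = belt y (p + 1, t)"
proof
  fix i
  obtain p' t' where "travel (shift y) i (p, t) = (p', t')" by fastforce
  then show "belt (shift y) (p, t) i = belt y (p + 1, t) i"
    by (simp add: belt_def travel_shift payload_shift)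
qed

section \<open>Acting on the belts\<close>

definition belt_map :: "(config \<Rightarrow> config) \<Rightarrow> config \<Rightarrow> config" where
  "belt_map \<phi> y = refill y (\<lambda>q. \<phi> (belt y q) 0)"

text \<open>
  The bit written at the \<open>i\<close>-th site of a belt is computed from the belt as read from that site,
  which is the translate by \<open>i\<close> of the belt as read from \<open>q\<close>.  As \<open>\<phi>\<close> commutes with translations,
  this bit is the \<open>i\<close>-th letter of the image of the whole belt.
\<close>

lemma belt_belt_map:
  assumes "shift_commuting \<phi>" "slot y (fst q)"
  shows "belt (belt_map \<phi> y) q = \<phi> (belt y q)"
proof
  fix i
  have "belt (belt_map \<phi> y) q i = \<phi> (belt y (travel y i q)) 0"
    using slot_travel[OF assms(2), of i]
    by (cases "travel y i q") (simp add: belt_map_def belt_def payload_refill)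
  also have "\<dots> = \<phi> (belt y q) i"
    using shift_commuting_translate[OF assms(1), of "belt y q" i] by (simp add: belt_travel)
  finally show "belt (belt_map \<phi> y) q i = \<phi> (belt y q) i" .
qed

lemma belt_map_comp:
  assumes "shift_commuting \<psi>"
  shows "belt_map \<phi> (belt_map \<psi> y) = belt_map (\<lambda>x. \<phi> (\<psi> x)) y"
proof -
  have "belt_map \<phi> (belt_map \<psi> y) = refill y (\<lambda>q. \<phi> (belt (belt_map \<psi> y) q) 0)"
    by (simp add: belt_map_def refill_refill)
  also have "\<dots> = belt_map (\<lambda>x. \<phi> (\<psi> x)) y"
    unfolding belt_map_def[of "\<lambda>x. \<phi> (\<psi> x)"]
    by (rule refill_cong) (simp add: belt_belt_map assms)
  finally show ?thesis .
qed

lemma belt_map_ident: "belt_map (\<lambda>x. x) y = y"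
  using refill_payload[of y] by (simp add: belt_map_def belt_def)

lemma belt_map_shift: "belt_map \<phi> (shift y) = shift (belt_map \<phi> y)"
proof -
  have "(\<lambda>q. \<phi> (belt (shift y) q) 0) = (\<lambda>(p, t). \<phi> (belt y (p + 1, t)) 0)"
    by (auto simp: belt_shift)
  then show ?thesis
    using refill_shift[of y "\<lambda>q. \<phi> (belt y q) 0"] by (simp add: belt_map_def)
qed

lemma eventually_slot_iff: "eventually (\<lambda>z. slot z p \<longleftrightarrow> slot y p) (nhds y)"
proof -
  have "eventually (\<lambda>z. \<forall>a\<in>UNIV. \<forall>b\<in>UNIV. occurs z p (D a b) \<longleftrightarrow> occurs y p (D a b)) (nhds y)"
    by (intro eventually_ball_finite ballI eventually_occurs_iff) auto
  then show ?thesis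
    using eventually_occurs_iff[of "p - int l" C y] eventually_occurs_iff[of "p + int l" C y]
    by eventually_elim (simp add: slot_def)
qed

lemma eventually_payload_eq: "eventually (\<lambda>z. payload z q = payload y q) (nhds y)"
proof -
  have "eventually (\<lambda>z. \<forall>a\<in>UNIV. \<forall>b\<in>UNIV.
      occurs z (fst q) (D a b) \<longleftrightarrow> occurs y (fst q) (D a b)) (nhds y)"
    by (intro eventually_ball_finite ballI eventually_occurs_iff) auto
  then show ?thesis
    by eventually_elim (simp add: payload_def)
qed

text \<open>
  Whether a step turns depends only on the slots at the current site and ahead of it, that is, on
  finitely many coordinates.
\<close>

lemma eventually_travel_eq: "eventually (\<lambda>z. travel z i q = travel y i q) (nhds y)"
proof -
  have jump: "eventually (\<lambda>z. jump z q = jump y q) (nhds y)" for q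
    using eventually_slot_iff[of "fst q" y] eventually_slot_iff[of "ahead q" y]
    by eventually_elim (simp add: jump_def)
  show ?thesis
  proof (induction i rule: int_induct[where k = 0])
    case (step1 i)
    from step1(2) jump[of "travel y i q"] show ?case
      by eventually_elim (simp add: travel_plus_1 advance_def)
  next
    case (step2 i)
    from step2(2) jump[of "flip (travel y i q)"] show ?case
      by eventually_elim (simp add: travel_minus_1 retreat_def)
  qed simp
qed

lemma tendsto_belt: "((\<lambda>z. belt z q) \<longlongrightarrow> belt y q) (nhds y)"
proof -
  have "eventually (\<lambda>z. belt z q i = belt y q i) (nhds y)" for i
    using eventually_travel_eq[of i q y] eventually_payload_eq[of "travel y i q" y]
    by eventually_elim (simp add: belt_def)
  then show ?thesis by (simp add: tendsto_config_iff)
qed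

text \<open>
  Inside a slot, the new letter is determined by two values of \<open>\<phi>\<close> at belts, and these are locally
  constant.  Outside all slots, nearby configurations have no slot over the coordinate either; only
  the finitely many start positions in \<open>(k - l, k]\<close> have to be checked.
\<close>

lemma continuous_belt_map:
  assumes "continuous_on UNIV \<phi>"
  shows "continuous_on UNIV (belt_map \<phi>)"
proof -
  have "eventually (\<lambda>z. belt_map \<phi> z k = belt_map \<phi> y k) (nhds y)" for y k
  proof (cases "\<exists>p. in_slot y k p")
    case True
    then obtain p where p: "in_slot y k p" ..
    have "eventually (\<lambda>z. \<phi> (belt z q) 0 = \<phi> (belt y q) 0) (nhds y)" for q
    proof (rule eventually_compose_filterlim[OF _ tendsto_belt])
      show "eventually (\<lambda>x. \<phi> x 0 = \<phi> (belt y q) 0) (nhds (belt y q))"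
        using assms by (simp add: continuous_on_config_iff)
    qed
    from this[of "(p, True)"] this[of "(p, False)"] eventually_slot_iff[of p y] show ?thesis
    proof eventually_elim
      case (elim z)
      then have "in_slot z k p" using p by (simp add: in_slot_def)
      with p elim show ?case by (simp add: belt_map_def refill_in_slot content_def)
    qed
  next
    case False
    have "eventually (\<lambda>z. \<forall>p\<in>{k - int l<..k}. slot z p \<longleftrightarrow> slot y p) (nhds y)"
      by (intro eventually_ball_finite ballI eventually_slot_iff) simp
    with eventually_coordinate[of k y] show ?thesis
    proof eventually_elim
      case (elim z)
      then have "\<nexists>p. in_slot z k p" using False by (auto simp: in_slot_def)
      with False elim show ?case by (simp add: belt_map_def refill_outside)
    qed
  qed
  then show ?thesis by (simp add: continuous_on_config_iff)
qed

lemma belt_map_in: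
  assumes "closed Y" "mutually_exchangeable (range (case_prod D)) Y" "y \<in> Y"
  shows "belt_map \<phi> y \<in> Y"
  unfolding belt_map_def using assms by (rule refill_in)

lemma periodic_config_nth:
  assumes "i < length w"
  shows "periodic_config w (int (length w) * j + int i) = w ! i"
  using assms by (simp add: periodic_config_def mod_add_left_eq)

lemma slot_periodic: "slot (periodic_config (C @ D a b)) (int l + 2 * int l * j)"
proof -
  let ?y = "periodic_config (C @ D a b)"
  have y: "?y (2 * int l * j + int i) = (C @ D a b) ! i" if "i < 2 * l" for i j
    using periodic_config_nth[of i "C @ D a b" j] that l_pos length_C length_D
    by (simp add: mult_2 [symmetric] flip: length_0_conv)
  have C: "occurs ?y (2 * int l * j) C" for j
    using y by (auto simp: occurs_def length_C nth_append)
  have "occurs ?y (2 * int l * j + int l) (D a b)"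
    using y[of "l + _" j] by (auto simp: occurs_def length_C length_D nth_append add_ac)
  with C[of j] C[of "j + 1"] show ?thesis
    by (auto simp: slot_def algebra_simps)
qed

text \<open>
  In the periodic point every \<open>D\<close> is a slot and all slots form one infinite chain, so its upper
  track is a belt that never turns; its \<open>i\<close>-th slot is at \<open>l + 2 l i\<close>.
\<close>

lemma every_config_on_belt:
  assumes "closed Y" "mutually_exchangeable (range (case_prod D)) Y"
    and "periodic_config (C @ D a b) \<in> Y"
  obtains y where "y \<in> Y" "slot y (int l)" "belt y (int l, True) = x"
proof
  let ?f = "\<lambda>q. x ((fst q - int l) div (2 * int l))"
  let ?y = "refill (periodic_config (C @ D a b)) ?f"
  show "?y \<in> Y" using assms by (rule refill_in)
  have slot: "slot ?y (int l + 2 * int l * j)" for j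
    using slot_periodic by simp
  show "slot ?y (int l)" using slot[of 0] by simp
  have travel: "travel ?y i (int l, True) = (int l + 2 * int l * i, True)" for i
  proof (induction i rule: int_induct[where k = 0])
    case (step1 i)
    have "slot ?y (int l + 2 * int l * i + 2 * int l)"
      using slot[of "i + 1"] by (simp add: algebra_simps)
    with step1 slot[of i] show ?case
      unfolding travel_plus_1 by (simp add: advance_def jump_def ahead_def flip_def algebra_simps)
  next
    case (step2 i)
    have "slot ?y (int l + 2 * int l * i - 2 * int l)"
      using slot[of "i - 1"] by (simp add: algebra_simps)
    with step2 slot[of i] show ?case
      unfolding travel_minus_1 by (simp add: retreat_def jump_def ahead_def flip_def algebra_simps)
  qed simp
  show "belt ?y (int l, True) = x"
    using slot_periodic l_pos by (intro ext) (simp only: belt_def travel, simp add: payload_refill)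
qed

text \<open>
  The inverse is the belt map of the inverse automorphism, by compatibility with composition.
\<close>

lemma belt_map_automorphism:
  assumes "subshift Y" "mutually_exchangeable (range (case_prod D)) Y" "\<phi> \<in> automorphisms UNIV"
  shows "restrict (belt_map \<phi>) Y \<in> automorphisms Y"
proof -
  have Y: "closed Y" "\<And>y. y \<in> Y \<Longrightarrow> shift y \<in> Y"
    using assms(1) by (auto simp: subshift_def)
  obtain \<psi> where h: "homeomorphism UNIV UNIV \<phi> \<psi>" and \<phi>: "shift_commuting \<phi>"
    using assms(3) by (auto simp: automorphisms_def shift_commuting_def)
  have inv: "\<phi> (\<psi> x) = x" "\<psi> (\<phi> x) = x" for x
    using h by (auto simp: homeomorphism_def)
  have \<psi>: "shift_commuting \<psi>"
    using \<phi> inv unfolding shift_commuting_def by metis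
  have "homeomorphism Y Y (belt_map \<phi>) (belt_map \<psi>)"
  proof (rule homeomorphismI)
    show "continuous_on Y (belt_map \<phi>)" "continuous_on Y (belt_map \<psi>)"
      using h continuous_belt_map continuous_on_subset[OF _ subset_UNIV]
      by (auto simp only: homeomorphism_def)
  qed (use belt_map_in[OF Y(1) assms(2)] in
      \<open>auto simp: belt_map_comp \<phi> \<psi> inv belt_map_ident\<close>)
  then have "homeomorphism Y Y (restrict (belt_map \<phi>) Y) (belt_map \<psi>)"
    by (rule homeomorphism_cong) auto
  then show ?thesis
    using Y(2) by (auto simp: automorphisms_def belt_map_shift)
qed

theorem belt_map_embedding:
  assumes Y: "subshift Y" and ex: "mutually_exchangeable (range (case_prod D)) Y"
    and per: "periodic_config (C @ D a b) \<in> Y"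
  defines "\<Phi> \<equiv> \<lambda>\<phi>. restrict (belt_map \<phi>) Y"
  shows "\<Phi> \<in> hom (Aut UNIV) (Aut Y)" "inj_on \<Phi> (carrier (Aut UNIV))"
proof -
  have Aut: "\<Phi> \<phi> \<in> automorphisms Y" if "\<phi> \<in> automorphisms UNIV" for \<phi>
    unfolding \<Phi>_def using Y ex that by (rule belt_map_automorphism)
  have sc: "shift_commuting \<phi>" if "\<phi> \<in> automorphisms UNIV" for \<phi>
    using that by (simp add: automorphisms_def shift_commuting_def)
  have cl: "closed Y" using Y by (simp add: subshift_def)
  show "\<Phi> \<in> hom (Aut UNIV) (Aut Y)"
  proof (rule homI)
    fix \<phi> \<psi> assume A: "\<phi> \<in> carrier (Aut UNIV)" "\<psi> \<in> carrier (Aut UNIV)"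
    then have \<phi>\<psi>: "\<phi> \<in> automorphisms UNIV" "\<psi> \<in> automorphisms UNIV"
      by (simp_all add: Aut_def)
    have "\<phi> \<otimes>\<^bsub>Aut UNIV\<^esub> \<psi> = compose UNIV \<phi> \<psi>"
      using \<phi>\<psi> automorphisms_subset_Bij by (auto simp: Aut_def BijGroup_def)
    moreover have "\<Phi> \<phi> \<otimes>\<^bsub>Aut Y\<^esub> \<Phi> \<psi> = compose Y (\<Phi> \<phi>) (\<Phi> \<psi>)"
      using \<phi>\<psi> Aut automorphisms_subset_Bij by (auto simp: Aut_def BijGroup_def)
    moreover have "compose UNIV \<phi> \<psi> = (\<lambda>x. \<phi> (\<psi> x))"
      by (simp add: compose_def fun_eq_iff)
    moreover have "\<Phi> (\<lambda>x. \<phi> (\<psi> x)) = compose Y (\<Phi> \<phi>) (\<Phi> \<psi>)"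
      using belt_map_in[OF cl ex] sc[OF \<phi>\<psi>(2)]
      by (auto simp: \<Phi>_def compose_def belt_map_comp)
    ultimately show "\<Phi> (\<phi> \<otimes>\<^bsub>Aut UNIV\<^esub> \<psi>) = \<Phi> \<phi> \<otimes>\<^bsub>Aut Y\<^esub> \<Phi> \<psi>"
      by simp
  qed (use Aut in \<open>simp add: Aut_def\<close>)
  show "inj_on \<Phi> (carrier (Aut UNIV))"
  proof (rule inj_onI, rule ext)
    fix \<phi> \<psi> x
    assume A: "\<phi> \<in> carrier (Aut UNIV)" "\<psi> \<in> carrier (Aut UNIV)" and eq: "\<Phi> \<phi> = \<Phi> \<psi>"
    obtain y where y: "y \<in> Y" "slot y (int l)" "belt y (int l, True) = x"
      by (rule every_config_on_belt[OF cl ex per])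
    have "belt_map \<phi> y = belt_map \<psi> y"
      using eq y(1) by (auto simp: \<Phi>_def dest: fun_cong[of _ _ y])
    then show "\<phi> x = \<psi> x"
      using A y sc belt_belt_map[of \<phi> y "(int l, True)"] belt_belt_map[of \<psi> y "(int l, True)"]
      by (simp add: Aut_def)
  qed
qed

end

section \<open>The embedding of the automorphism group of the full shift\<close>

theorem proposition2p1:
  fixes Y :: "config set" and D :: "bool \<Rightarrow> bool \<Rightarrow> block" and C :: block and l :: nat
  assumes "subshift Y"
    and "\<And>\<epsilon> \<delta>. length (D \<epsilon> \<delta>) = l" and "length C = l"
    and "\<And>\<epsilon> \<delta>. appears_in (D \<epsilon> \<delta>) Y" and "appears_in C Y"
    and "distinct [D False False, D False True, D True False, D True True, C]"
    and "mutually_exchangeable {D False False, D False True, D True False, D True True} Y"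
    and "\<And>\<epsilon> \<delta> m. m \<le> l \<Longrightarrow> C = subword (D \<epsilon> \<delta> @ C) (m + 1) (m + l) \<Longrightarrow> m = l"
    and "\<And>\<epsilon> \<delta> m. m \<le> l \<Longrightarrow> C = subword (C @ D \<epsilon> \<delta>) (m + 1) (m + l) \<Longrightarrow> m = 0"
    and "periodic_config (C @ D False False) \<in> Y"
  shows "\<exists>\<Phi>. \<Phi> \<in> hom (Aut UNIV) (Aut Y) \<and> inj_on \<Phi> (carrier (Aut UNIV))"
proof -
  interpret conveyor D C l
  proof
    show "0 < l"
      using assms(2)[of False False] assms(3,6) by (cases l) auto
  next
    fix a b a' b' assume "D a b = D a' b'"
    then show "a = a' \<and> b = b'"
      using assms(6) by (cases a; cases b; cases a'; cases b') auto
  next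
    fix y p a b q
    assume *: "occurs y p (D a b)" "occurs y (p + int l) C" "occurs y q C" "p \<le> q" "q \<le> p + int l"
    have "C = subword (D a b @ C) (nat (q - p) + 1) (nat (q - p) + l)"
      using * assms(2,3) by (intro subword_of_append[of y p]) auto
    with * have "nat (q - p) = l" by (intro assms(8)) auto
    with * show "q = p + int l" by auto
  next
    fix y p a b q
    assume *: "occurs y (p - int l) C" "occurs y p (D a b)" "occurs y q C" "p - int l \<le> q" "q \<le> p"
    have "C = subword (C @ D a b) (nat (q - (p - int l)) + 1) (nat (q - (p - int l)) + l)"
      using * assms(2,3) by (intro subword_of_append[of y "p - int l"]) auto
    with * have "nat (q - (p - int l)) = 0" by (intro assms(9)) auto
    with * show "q = p - int l" by auto
  qed (use assms in auto)
  have "range (case_prod D) = {D False False, D False True, D True False, D True True}"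
    by (auto simp: UNIV_bool simp flip: UNIV_Times_UNIV)
  then show ?thesis
    using belt_map_embedding[of Y False False] assms by metis
qed

end
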